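(* Let $X$ be a graph, let $\{Y_x\}_{x\in V(X)}$ be a family of graphs, and let $Z$ be the $X$-join of $\{Y_x\}_{x\in V(X)}$. Suppose that every automorphism of $Z$ is natural. Let $S$ be the set of all (non-equivalent) distinguishing colorings of $X$ with $D(X)$ colors, i.e. a set containing one representative of each equivalence class of such colorings. Then $$D(Z)\leq \min\{d_f : f\in S\}.$$
   Context: All graphs are finite, simple and undirected (with nonempty vertex set). A vertex coloring of a graph $G$ (not necessarily proper) is distinguishing if the only automorphism of $G$ preserving the color of every vertex is the identity. The distinguishing number $D(G)$ is the least number of colors in a distinguishing coloring of $G$. Two colorings $c_1,c_2$ of $G$ are equivalent if there is an automorphism $\alpha$ of $G$ with $c_1(v)=c_2(\alpha(v))$ for all $v\in V(G)$. For a positive integer $k$, $\Phi_k(G)$ is the number of non-equivalent distinguishing colorings (i.e. equivalence classes of distinguishing colorings) $c:V(G)\to\{1,\dots,k\}$, where not all $k$ colors need be used. The $X$-join of $\{Y_x\}_{x\in V(X)}$ is the graph $Z$ with vertex set $\{(x,y): x\in V(X),\ y\in V(Y_x)\}$ in which $(x,y)$ is adjacent to $(x',y')$ if and only if either $xx'\in E(X)$, or $x=x'$ and $yy'\in E(Y_x)$. We identify $Y_x$ with the set of vertices of $Z$ having first coordinate $x$. An automorphism $\mu$ of $Z$ is natural if for every $x_1\in V(X)$ there is $x_2\in V(X)$ with $\mu(Y_{x_1})=Y_{x_2}$. For a distinguishing coloring $f$ of $X$ with $D(X)$ colors and $x\in V(X)$, put $$C(x)=\{w\in V(X): f(x)\neq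 f(w)\text{ and } Y_x\simeq Y_w\}\cup\{x\},$$ $$D_x=\min\{k: \Phi_k(Y_x)\geq |C(x)|\},\qquad d_f=\max\{D_x: x\in V(X)\}.$$ *)

theory Defs
  imports
    "Graph_Theory.Pair_Digraph"
    "Graph_Theory.Digraph_Isomorphism"
    "HOL-Library.FuncSet"
begin

text \<open>
  A \<open>pair_graph\<close> is a finite, loop-free digraph given by a symmetric set of ordered pairs,
  i.e. a finite simple undirected graph in which the edge \<open>uv\<close> is present as both
  \<open>(u, v)\<close> and \<open>(v, u)\<close>.
\<close>

definition fin_simple_graph :: "'a pair_pre_digraph \<Rightarrow> bool" where
  "fin_simple_graph G \<longleftrightarrow> pair_graph G \<and> pverts G \<noteq> {}"

text \<open>
  Isomorphisms and automorphisms are represented by total functions of which only the values on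
  the vertex set matter.
\<close>

definition graph_isomorphism ::
    "'a pair_pre_digraph \<Rightarrow> 'b pair_pre_digraph \<Rightarrow> ('a \<Rightarrow> 'b) \<Rightarrow> bool" where
  "graph_isomorphism G H \<phi> \<longleftrightarrow>
     bij_betw \<phi> (pverts G) (pverts H) \<and>
     (\<forall>u\<in>pverts G. \<forall>v\<in>pverts G. (u, v) \<in> parcs G \<longleftrightarrow> (\<phi> u, \<phi> v) \<in> parcs H)"

definition isomorphic_graphs :: "'a pair_pre_digraph \<Rightarrow> 'b pair_pre_digraph \<Rightarrow> bool" where
  "isomorphic_graphs G H \<longleftrightarrow> (\<exists>\<phi>. graph_isomorphism G H \<phi>)"

definition graph_automorphism :: "'a pair_pre_digraph \<Rightarrow> ('a \<Rightarrow> 'a) \<Rightarrow> bool" where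
  "graph_automorphism G \<alpha> \<longleftrightarrow> graph_isomorphism G G \<alpha>"

text \<open>
  The vertex map suffices as there are no parallel arcs: this is the library's isomorphism of
  digraphs, which carries a separate map on arcs.
\<close>

lemma isomorphic_graphs_iff_digraph_iso:
  assumes "pair_graph G" "pair_graph H"
  shows "isomorphic_graphs G H \<longleftrightarrow> digraph_iso (with_proj G) (with_proj H)"
proof
  interpret G: pair_graph G by fact
  interpret H: pair_graph H by fact
  assume "isomorphic_graphs G H"
  then obtain p where bij: "bij_betw p (pverts G) (pverts H)"
    and adj: "\<And>u v. u \<in> pverts G \<Longrightarrow> v \<in> pverts G \<Longrightarrow>
                (u, v) \<in> parcs G \<longleftrightarrow> (p u, p v) \<in> parcs H"
    unfolding isomorphic_graphs_def graph_isomorphism_def by blast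
  define f where "f = \<lparr> iso_verts = p, iso_arcs = (\<lambda>e. (p (fst e), p (snd e))),
                       iso_head = snd, iso_tail = fst \<rparr>"
  have inj: "inj_on p (pverts G)" using bij by (rule bij_betw_imp_inj_on)
  have "inj_on (iso_arcs f) (parcs G)"
  proof (rule inj_onI)
    fix a b assume a: "a \<in> parcs G" "b \<in> parcs G" "iso_arcs f a = iso_arcs f b"
    then have "p (fst a) = p (fst b)" "p (snd a) = p (snd b)" by (auto simp: f_def)
    then show "a = b"
      using inj a(1,2) G.arc_fst_in_verts G.arc_snd_in_verts
      by (meson inj_onD prod_eq_iff)
  qed
  then have "pre_digraph.digraph_isomorphism (with_proj G) f"
    using inj G.wf_digraph_axioms by (simp add: pre_digraph.digraph_isomorphism_def f_def)
  moreover have "parcs H = (\<lambda>e. (p (fst e), p (snd e))) ` parcs G"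
  proof (intro set_eqI iffI)
    fix e assume e: "e \<in> parcs H"
    then obtain u v where uv: "u \<in> pverts G" "v \<in> pverts G" "fst e = p u" "snd e = p v"
      using H.arc_fst_in_verts H.arc_snd_in_verts bij unfolding bij_betw_def
      by (metis (no_types, lifting) imageE)
    then have "(u, v) \<in> parcs G" using adj e by (metis prod.collapse)
    then show "e \<in> (\<lambda>e. (p (fst e), p (snd e))) ` parcs G"
      using uv by (intro image_eqI[of _ _ "(u, v)"]) (auto simp: prod_eq_iff)
  next
    fix e assume "e \<in> (\<lambda>e. (p (fst e), p (snd e))) ` parcs G"
    then obtain u v where uv: "(u, v) \<in> parcs G" "e = (p u, p v)" by auto
    then show "e \<in> parcs H" using adj[OF G.wellformed'[OF uv(1)]] by simp
  qed
  ultimately have "with_proj H = app_iso f (with_proj G)"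
    using bij by (simp add: app_iso_def f_def with_proj_def bij_betw_def)
  with \<open>pre_digraph.digraph_isomorphism (with_proj G) f\<close>
  show "digraph_iso (with_proj G) (with_proj H)" unfolding digraph_iso_def by blast
next
  interpret G: pair_graph G by fact
  interpret H: pair_graph H by fact
  assume "digraph_iso (with_proj G) (with_proj H)"
  then obtain f where f: "pre_digraph.digraph_isomorphism (with_proj G) f"
    and H: "with_proj H = app_iso f (with_proj G)" unfolding digraph_iso_def by blast
  let ?p = "iso_verts f"
  have vH: "pverts H = ?p ` pverts G" and aH: "parcs H = iso_arcs f ` parcs G"
    and t: "iso_tail f = fst" and h: "iso_head f = snd"
    using H by (auto simp: app_iso_def with_proj_def)
  have inj: "inj_on ?p (pverts G)"
    and ends: "\<And>a. a \<in> parcs G \<Longrightarrow> iso_arcs f a = (?p (fst a), ?p (snd a))"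
    using f t h by (auto simp: pre_digraph.digraph_isomorphism_def prod_eq_iff)
  have "graph_isomorphism G H ?p"
    unfolding graph_isomorphism_def
  proof (intro conjI ballI iffI)
    show "bij_betw ?p (pverts G) (pverts H)" using inj vH by (simp add: bij_betw_def)
  next
    fix u v assume "(u, v) \<in> parcs G"
    then show "(?p u, ?p v) \<in> parcs H" using ends aH by force
  next
    fix u v assume uv: "u \<in> pverts G" "v \<in> pverts G" "(?p u, ?p v) \<in> parcs H"
    then obtain a where a: "a \<in> parcs G" "?p u = ?p (fst a)" "?p v = ?p (snd a)"
      using aH ends by auto
    then have "u = fst a" "v = snd a"
      using inj uv G.arc_fst_in_verts G.arc_snd_in_verts by (auto dest: inj_onD)
    then show "(u, v) \<in> parcs G" using a by simp
  qed
  then show "isomorphic_graphs G H" unfolding isomorphic_graphs_def by blast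
qed

definition distinguishing :: "'a pair_pre_digraph \<Rightarrow> ('a \<Rightarrow> nat) \<Rightarrow> bool" where
  "distinguishing G c \<longleftrightarrow>
     (\<forall>\<alpha>. graph_automorphism G \<alpha> \<and> (\<forall>v\<in>pverts G. c (\<alpha> v) = c v)
          \<longrightarrow> (\<forall>v\<in>pverts G. \<alpha> v = v))"

text \<open>
  The colorings are extensional (undefined outside the vertex set), so that they correspond
  one-to-one to functions \<open>V(G) \<rightarrow> {1,\<dots>,k}\<close>. Not all \<open>k\<close> colors need be used.
\<close>

definition dist_colorings :: "'a pair_pre_digraph \<Rightarrow> nat \<Rightarrow> ('a \<Rightarrow> nat) set" where
  "dist_colorings G k = {c \<in> pverts G \<rightarrow>\<^sub>E {1..k}. distinguishing G c}"

definition distinguishing_number :: "'a pair_pre_digraph \<Rightarrow> nat" where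
  "distinguishing_number G = (LEAST k. dist_colorings G k \<noteq> {})"

definition equivalent_colorings ::
    "'a pair_pre_digraph \<Rightarrow> ('a \<Rightarrow> nat) \<Rightarrow> ('a \<Rightarrow> nat) \<Rightarrow> bool" where
  "equivalent_colorings G c\<^sub>1 c\<^sub>2 \<longleftrightarrow>
     (\<exists>\<alpha>. graph_automorphism G \<alpha> \<and> (\<forall>v\<in>pverts G. c\<^sub>1 v = c\<^sub>2 (\<alpha> v)))"

definition dist_coloring_rel :: "'a pair_pre_digraph \<Rightarrow> nat \<Rightarrow> ('a \<Rightarrow> nat) rel" where
  "dist_coloring_rel G k =
     {(c\<^sub>1, c\<^sub>2) \<in> dist_colorings G k \<times> dist_colorings G k. equivalent_colorings G c\<^sub>1 c\<^sub>2}"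

lemma graph_automorphism_the_inv:
  assumes "graph_automorphism G \<alpha>"
  shows "graph_automorphism G (the_inv_into (pverts G) \<alpha>)"
proof -
  let ?b = "the_inv_into (pverts G) \<alpha>"
  have bij: "bij_betw \<alpha> (pverts G) (pverts G)"
    and adj: "\<And>u v. u \<in> pverts G \<Longrightarrow> v \<in> pverts G \<Longrightarrow>
                (u, v) \<in> parcs G \<longleftrightarrow> (\<alpha> u, \<alpha> v) \<in> parcs G"
    using assms unfolding graph_automorphism_def graph_isomorphism_def by blast+
  have b: "bij_betw ?b (pverts G) (pverts G)" using bij by (rule bij_betw_the_inv_into)
  have "?b v \<in> pverts G" "\<alpha> (?b v) = v" if "v \<in> pverts G" for v
    using that b bij by (auto simp: bij_betw_def f_the_inv_into_f)
  then show ?thesis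
    using b adj unfolding graph_automorphism_def graph_isomorphism_def by metis
qed

lemma equiv_dist_coloring_rel: "equiv (dist_colorings G k) (dist_coloring_rel G k)"
proof (rule equivI)
  show "dist_coloring_rel G k \<subseteq> dist_colorings G k \<times> dist_colorings G k"
    by (auto simp: dist_coloring_rel_def)
  have "graph_automorphism G (\<lambda>v. v)"
    by (auto simp: graph_automorphism_def graph_isomorphism_def bij_betw_def)
  then show "refl_on (dist_colorings G k) (dist_coloring_rel G k)"
    by (auto simp: refl_on_def dist_coloring_rel_def equivalent_colorings_def)
  show "sym (dist_coloring_rel G k)"
  proof (rule symI)
    fix c d assume cd: "(c, d) \<in> dist_coloring_rel G k"
    then obtain \<alpha> where a: "graph_automorphism G \<alpha>" "\<And>v. v \<in> pverts G \<Longrightarrow> c v = d (\<alpha> v)"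
      by (auto simp: dist_coloring_rel_def equivalent_colorings_def)
    let ?b = "the_inv_into (pverts G) \<alpha>"
    have bij: "bij_betw \<alpha> (pverts G) (pverts G)"
      using a(1) by (auto simp: graph_automorphism_def graph_isomorphism_def)
    have "d v = c (?b v)" if "v \<in> pverts G" for v
    proof -
      have "?b v \<in> pverts G" using bij_betwE[OF bij_betw_the_inv_into[OF bij]] that by blast
      moreover have "\<alpha> (?b v) = v" using bij that by (simp add: bij_betw_def f_the_inv_into_f)
      ultimately show ?thesis using a(2) by metis
    qed
    then show "(d, c) \<in> dist_coloring_rel G k"
      using cd graph_automorphism_the_inv[OF a(1)]
      by (auto simp: dist_coloring_rel_def equivalent_colorings_def)
  qed
  show "trans (dist_coloring_rel G k)"
  proof (rule transI)
    fix c d e assume cd: "(c, d) \<in> dist_coloring_rel G k" and de: "(d, e) \<in> dist_coloring_rel G k"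
    then obtain \<alpha> \<beta> where ab: "graph_automorphism G \<alpha>" "graph_automorphism G \<beta>"
      and cs: "\<And>v. v \<in> pverts G \<Longrightarrow> c v = d (\<alpha> v)" "\<And>v. v \<in> pverts G \<Longrightarrow> d v = e (\<beta> v)"
      by (auto simp: dist_coloring_rel_def equivalent_colorings_def)
    have mem: "\<alpha> v \<in> pverts G" if "v \<in> pverts G" for v
      using that ab(1) by (auto simp: graph_automorphism_def graph_isomorphism_def bij_betw_def)
    have "graph_automorphism G (\<beta> \<circ> \<alpha>)"
      unfolding graph_automorphism_def graph_isomorphism_def
    proof (intro conjI ballI)
      show "bij_betw (\<beta> \<circ> \<alpha>) (pverts G) (pverts G)"
        using ab unfolding graph_automorphism_def graph_isomorphism_def
        by (blast intro: bij_betw_trans)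
    next
      fix u v assume "u \<in> pverts G" "v \<in> pverts G"
      then show "(u, v) \<in> parcs G \<longleftrightarrow> ((\<beta> \<circ> \<alpha>) u, (\<beta> \<circ> \<alpha>) v) \<in> parcs G"
        using ab mem unfolding graph_automorphism_def graph_isomorphism_def comp_def by metis
    qed
    moreover have "\<forall>v\<in>pverts G. c v = e ((\<beta> \<circ> \<alpha>) v)" using cs mem by simp
    ultimately show "(c, e) \<in> dist_coloring_rel G k"
      using cd de unfolding dist_coloring_rel_def equivalent_colorings_def by blast
  qed
qed

definition num_dist_colorings :: "nat \<Rightarrow> 'a pair_pre_digraph \<Rightarrow> nat"  ("\<Phi>") where
  "\<Phi> k G = card (dist_colorings G k // dist_coloring_rel G k)"

definition X_join ::
    "'a pair_pre_digraph \<Rightarrow> ('a \<Rightarrow> 'b pair_pre_digraph) \<Rightarrow> ('a \<times> 'b) pair_pre_digraph" where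
  "X_join X Y =
     \<lparr> pverts = (SIGMA x : pverts X. pverts (Y x)),
       parcs = {((x, y), (x', y')).
                  x \<in> pverts X \<and> y \<in> pverts (Y x) \<and> x' \<in> pverts X \<and> y' \<in> pverts (Y x') \<and>
                  ((x, x') \<in> parcs X \<or> (x = x' \<and> (y, y') \<in> parcs (Y x)))} \<rparr>"

lemma fin_simple_graph_X_join:
  assumes X: "fin_simple_graph X" and Y: "\<And>x. x \<in> pverts X \<Longrightarrow> fin_simple_graph (Y x)"
  shows "fin_simple_graph (X_join X Y)"
proof -
  interpret X: pair_graph X using X by (simp add: fin_simple_graph_def)
  have Yg: "pair_graph (Y x)" "pverts (Y x) \<noteq> {}" if "x \<in> pverts X" for x
    using Y[OF that] by (auto simp: fin_simple_graph_def)
  have fin: "finite (pverts (X_join X Y))"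
    using Yg X.pair_finite_verts
    by (auto simp: X_join_def pair_graph_def pair_digraph_def pair_fin_digraph_def
        pair_fin_digraph_axioms_def intro!: finite_SigmaI)
  have sub: "parcs (X_join X Y) \<subseteq> pverts (X_join X Y) \<times> pverts (X_join X Y)"
    by (auto simp: X_join_def)
  have symX: "(v, u) \<in> parcs X" if "(u, v) \<in> parcs X" for u v
    using X.pair_sym_arcs that by (auto simp: symmetric_def dest: symD)
  have symY: "(v, u) \<in> parcs (Y x)" if "(u, v) \<in> parcs (Y x)" "x \<in> pverts X" for u v x
  proof -
    interpret Yx: pair_graph "Y x" using Yg(1) that(2) .
    show ?thesis using Yx.pair_sym_arcs that(1) by (auto simp: symmetric_def dest: symD)
  qed
  have loopY: "u \<noteq> v" if "(u, v) \<in> parcs (Y x)" "x \<in> pverts X" for u v x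
  proof -
    interpret Yx: pair_graph "Y x" using Yg(1) that(2) .
    show ?thesis using Yx.pair_no_loops[OF that(1)] by simp
  qed
  have "pair_graph (X_join X Y)"
  proof unfold_locales
    show "finite (pverts (X_join X Y))" by (rule fin)
    show "finite (parcs (X_join X Y))" using sub fin by (meson finite_SigmaI finite_subset)
    show "symmetric (with_proj (X_join X Y))"
      using symX symY by (auto simp: symmetric_def X_join_def intro!: symI)
  next
    fix e assume e: "e \<in> parcs (X_join X Y)"
    then show "fst e \<in> pverts (X_join X Y)" "snd e \<in> pverts (X_join X Y)" using sub by auto
    show "fst e \<noteq> snd e" using e loopY X.pair_no_loops by (fastforce simp: X_join_def)
  qed
  moreover have "pverts (X_join X Y) \<noteq> {}"
    using X Yg(2) by (auto simp: X_join_def fin_simple_graph_def)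
  ultimately show ?thesis by (simp add: fin_simple_graph_def)
qed

definition fibre :: "('a \<Rightarrow> 'b pair_pre_digraph) \<Rightarrow> 'a \<Rightarrow> ('a \<times> 'b) set" where
  "fibre Y x = {x} \<times> pverts (Y x)"

definition natural ::
    "'a pair_pre_digraph \<Rightarrow> ('a \<Rightarrow> 'b pair_pre_digraph) \<Rightarrow> ('a \<times> 'b \<Rightarrow> 'a \<times> 'b) \<Rightarrow> bool" where
  "natural X Y \<mu> \<longleftrightarrow>
     (\<forall>x\<^sub>1\<in>pverts X. \<exists>x\<^sub>2\<in>pverts X. \<mu> ` fibre Y x\<^sub>1 = fibre Y x\<^sub>2)"

definition C_set ::
    "'a pair_pre_digraph \<Rightarrow> ('a \<Rightarrow> 'b pair_pre_digraph) \<Rightarrow> ('a \<Rightarrow> nat) \<Rightarrow> 'a \<Rightarrow> 'a set" where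
  "C_set X Y f x =
     {w \<in> pverts X. f x \<noteq> f w \<and> isomorphic_graphs (Y x) (Y w)} \<union> {x}"

definition D_at ::
    "'a pair_pre_digraph \<Rightarrow> ('a \<Rightarrow> 'b pair_pre_digraph) \<Rightarrow> ('a \<Rightarrow> nat) \<Rightarrow> 'a \<Rightarrow> nat" where
  "D_at X Y f x = (LEAST k. 1 \<le> k \<and> \<Phi> k (Y x) \<ge> card (C_set X Y f x))"

definition d_max ::
    "'a pair_pre_digraph \<Rightarrow> ('a \<Rightarrow> 'b pair_pre_digraph) \<Rightarrow> ('a \<Rightarrow> nat) \<Rightarrow> nat" where
  "d_max X Y f = Max (D_at X Y f ` pverts X)"

text \<open>
  \<open>d_max\<close> is in general not invariant under equivalence of colorings of \<open>X\<close>, so the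
  choice of representatives matters.
\<close>

definition dist_coloring_representatives ::
    "'a pair_pre_digraph \<Rightarrow> nat \<Rightarrow> ('a \<Rightarrow> nat) set \<Rightarrow> bool" where
  "dist_coloring_representatives G k S \<longleftrightarrow>
     S \<subseteq> dist_colorings G k \<and>
     (\<forall>c\<in>dist_colorings G k. \<exists>!f. f \<in> S \<and> equivalent_colorings G c f)"

end

theory Submission
  imports Defs
begin

text \<open>
  Fix a distinguishing coloring \<open>f\<close> of \<open>X\<close> and let \<open>k = d_max X Y f\<close>. The aim is a distinguishing
  coloring of \<open>Z\<close> with \<open>k\<close> colors. Color each fibre \<open>Y x\<close> by a distinguishing coloring \<open>h x\<close>, chosen
  such that the colored graphs \<open>(Y x, h x)\<close> and \<open>(Y w, h w)\<close> are non-isomorphic whenever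
  \<open>f x \<noteq> f w\<close>. The union of these colorings is distinguishing: a natural automorphism \<open>\<mu>\<close> of
  \<open>Z\<close> permutes the fibres, and the permutation \<open>\<pi>\<close> of \<open>V(X)\<close> that it induces is an
  automorphism of \<open>X\<close>, since adjacency of vertices in different fibres is decided in \<open>X\<close>. If
  \<open>\<mu>\<close> preserves colors, then it maps \<open>(Y x, h x)\<close> isomorphically to \<open>(Y (\<pi> x), h (\<pi> x))\<close>, so
  \<open>f (\<pi> x) = f x\<close> for all \<open>x\<close>. As \<open>f\<close> is distinguishing, \<open>\<pi>\<close> is the identity; hence
  \<open>\<mu>\<close> restricts to a color-preserving automorphism of every fibre, and these are trivial
  because each \<open>h x\<close> is distinguishing (lemmas \<open>natural_automorphism_induces\<close> and
  \<open>distinguishing_X_join\<close>).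

  Only the values of \<open>f\<close> on an isomorphism class of fibres have to be told apart, by pairwise
  non-equivalent colorings of a single representative of the class that are carried over to the
  other members. All these values are taken on the set \<open>C_set X Y f x\<close>, so its size bounds
  their number, and \<open>\<Phi> k (Y x)\<close> is at least this size by the choice of \<open>k\<close> (lemmas
  \<open>exists_fibre_colorings\<close> and \<open>card_base_colors_le_num_dist_colorings\<close>).
\<close>

section \<open>Isomorphisms of colored graphs\<close>

lemma fin_simple_graph_finite: "fin_simple_graph G \<Longrightarrow> finite (pverts G)"
  by (simp add: fin_simple_graph_def pair_graph_def pair_digraph_def pair_fin_digraph_def
      pair_fin_digraph_axioms_def)

lemma graph_isomorphism_id: "graph_isomorphism G G (\<lambda>v. v)"
  by (simp add: graph_isomorphism_def bij_betw_def)

lemma graph_isomorphism_mem: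
  "graph_isomorphism G H \<phi> \<Longrightarrow> v \<in> pverts G \<Longrightarrow> \<phi> v \<in> pverts H"
  by (auto simp: graph_isomorphism_def bij_betw_def)

lemma graph_automorphism_mem:
  "graph_automorphism G \<alpha> \<Longrightarrow> v \<in> pverts G \<Longrightarrow> \<alpha> v \<in> pverts G"
  unfolding graph_automorphism_def by (rule graph_isomorphism_mem)

lemma graph_isomorphism_comp:
  assumes "graph_isomorphism G H \<phi>" "graph_isomorphism H K \<psi>"
  shows "graph_isomorphism G K (\<lambda>v. \<psi> (\<phi> v))"
proof -
  have "bij_betw (\<psi> \<circ> \<phi>) (pverts G) (pverts K)"
    using assms unfolding graph_isomorphism_def by (blast intro: bij_betw_trans)
  then show ?thesis
    using assms graph_isomorphism_mem[OF assms(1)]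
    unfolding graph_isomorphism_def comp_def by simp
qed

lemma graph_isomorphism_the_inv:
  assumes "graph_isomorphism G H \<phi>"
  shows "graph_isomorphism H G (the_inv_into (pverts G) \<phi>)"
proof -
  let ?b = "the_inv_into (pverts G) \<phi>"
  have bij: "bij_betw \<phi> (pverts G) (pverts H)"
    using assms by (simp add: graph_isomorphism_def)
  have b: "bij_betw ?b (pverts H) (pverts G)" using bij by (rule bij_betw_the_inv_into)
  have "?b v \<in> pverts G" "\<phi> (?b v) = v" if "v \<in> pverts H" for v
    using that b bij by (auto simp: bij_betw_def f_the_inv_into_f)
  then show ?thesis using b assms unfolding graph_isomorphism_def by metis
qed

lemma isomorphic_graphs_refl: "isomorphic_graphs G G"
  using graph_isomorphism_id unfolding isomorphic_graphs_def by blast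

lemma isomorphic_graphs_sym: "isomorphic_graphs G H \<Longrightarrow> isomorphic_graphs H G"
  using graph_isomorphism_the_inv unfolding isomorphic_graphs_def by blast

lemma isomorphic_graphs_trans:
  "isomorphic_graphs G H \<Longrightarrow> isomorphic_graphs H K \<Longrightarrow> isomorphic_graphs G K"
  using graph_isomorphism_comp unfolding isomorphic_graphs_def by blast

text \<open>
  Equivalence of colorings compares colorings of one graph; comparing the fibres of a join needs
  the version for two different graphs.
\<close>

definition color_isomorphic ::
    "'a pair_pre_digraph \<Rightarrow> ('a \<Rightarrow> nat) \<Rightarrow> 'b pair_pre_digraph \<Rightarrow> ('b \<Rightarrow> nat) \<Rightarrow> bool" where
  "color_isomorphic G c H d \<longleftrightarrow>
     (\<exists>\<phi>. graph_isomorphism G H \<phi> \<and> (\<forall>v\<in>pverts G. c v = d (\<phi> v)))"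

lemma color_isomorphic_same_graph:
  "color_isomorphic G c G d \<longleftrightarrow> equivalent_colorings G c d"
  by (simp add: color_isomorphic_def equivalent_colorings_def graph_automorphism_def)

lemma color_isomorphic_imp_isomorphic:
  "color_isomorphic G c H d \<Longrightarrow> isomorphic_graphs G H"
  by (auto simp: color_isomorphic_def isomorphic_graphs_def)

lemma color_isomorphic_sym:
  assumes "color_isomorphic G c H d"
  shows "color_isomorphic H d G c"
proof -
  obtain \<phi> where \<phi>: "graph_isomorphism G H \<phi>" "\<forall>v\<in>pverts G. c v = d (\<phi> v)"
    using assms by (auto simp: color_isomorphic_def)
  let ?b = "the_inv_into (pverts G) \<phi>"
  have inv: "graph_isomorphism H G ?b" using \<phi>(1) by (rule graph_isomorphism_the_inv)
  have "d v = c (?b v)" if "v \<in> pverts H" for v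
  proof -
    have "\<phi> (?b v) = v"
      using \<phi>(1) that by (simp add: graph_isomorphism_def bij_betw_def f_the_inv_into_f)
    then show ?thesis using \<phi>(2) graph_isomorphism_mem[OF inv that] by simp
  qed
  then show ?thesis using inv unfolding color_isomorphic_def by blast
qed

lemma color_isomorphic_trans:
  assumes "color_isomorphic G c H d" "color_isomorphic H d K e"
  shows "color_isomorphic G c K e"
proof -
  obtain \<phi> \<psi> where
    \<phi>: "graph_isomorphism G H \<phi>" "\<forall>v\<in>pverts G. c v = d (\<phi> v)" and
    \<psi>: "graph_isomorphism H K \<psi>" "\<forall>v\<in>pverts H. d v = e (\<psi> v)"
    using assms by (auto simp: color_isomorphic_def)
  have "\<forall>v\<in>pverts G. c v = e (\<psi> (\<phi> v))"
    using \<phi> \<psi>(2) graph_isomorphism_mem[OF \<phi>(1)] by simp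
  then show ?thesis
    using graph_isomorphism_comp[OF \<phi>(1) \<psi>(1)] unfolding color_isomorphic_def by blast
qed

text \<open>
  Conjugation by an isomorphism \<open>\<phi>\<close> turns a color-preserving automorphism \<open>\<alpha>\<close> of the first
  colored graph into the color-preserving automorphism \<open>\<phi> \<circ> \<alpha> \<circ> \<phi>\<inverse>\<close> of the second.
\<close>

lemma distinguishing_color_isomorphic:
  assumes "color_isomorphic G c H d" "distinguishing H d"
  shows "distinguishing G c"
  unfolding distinguishing_def
proof (intro allI impI ballI)
  fix \<alpha> v
  assume \<alpha>: "graph_automorphism G \<alpha> \<and> (\<forall>v\<in>pverts G. c (\<alpha> v) = c v)" and v: "v \<in> pverts G"
  obtain \<phi> where \<phi>: "graph_isomorphism G H \<phi>" "\<And>v. v \<in> pverts G \<Longrightarrow> c v = d (\<phi> v)"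
    using assms(1) by (auto simp: color_isomorphic_def)
  let ?b = "the_inv_into (pverts G) \<phi>"
  have inj: "inj_on \<phi> (pverts G)"
    using \<phi>(1) by (simp add: graph_isomorphism_def bij_betw_def)
  have inv: "graph_isomorphism H G ?b" using \<phi>(1) by (rule graph_isomorphism_the_inv)
  have \<alpha>_iso: "graph_isomorphism G G \<alpha>" using \<alpha> by (simp add: graph_automorphism_def)
  have "graph_automorphism H (\<lambda>u. \<phi> (\<alpha> (?b u)))"
    unfolding graph_automorphism_def
    using graph_isomorphism_comp[OF graph_isomorphism_comp[OF inv \<alpha>_iso] \<phi>(1)] .
  moreover have "d (\<phi> (\<alpha> (?b u))) = d u" if u: "u \<in> pverts H" for u
  proof -
    have b: "?b u \<in> pverts G" using graph_isomorphism_mem[OF inv u] .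
    have "\<phi> (?b u) = u"
      using \<phi>(1) u by (simp add: graph_isomorphism_def bij_betw_def f_the_inv_into_f)
    moreover have "d (\<phi> (\<alpha> (?b u))) = c (\<alpha> (?b u))"
      using \<phi>(2)[OF graph_isomorphism_mem[OF \<alpha>_iso b]] by simp
    ultimately show ?thesis using \<alpha> b \<phi>(2)[OF b] by simp
  qed
  ultimately have "\<phi> (\<alpha> (?b (\<phi> v))) = \<phi> v"
    using assms(2) graph_isomorphism_mem[OF \<phi>(1) v] unfolding distinguishing_def by blast
  moreover have "?b (\<phi> v) = v" using inj v by (rule the_inv_into_f_f)
  ultimately show "\<alpha> v = v"
    using inj v graph_isomorphism_mem[OF \<alpha>_iso v] by (auto dest: inj_onD)
qed

section \<open>Counting distinguishing colorings\<close>

lemma finite_dist_colorings: "finite (pverts G) \<Longrightarrow> finite (dist_colorings G k)"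
  by (rule finite_subset[of _ "pverts G \<rightarrow>\<^sub>E {1..k}"])
    (auto simp: dist_colorings_def intro: finite_PiE)

lemma dist_coloring_class_eq_iff:
  assumes "c \<in> dist_colorings G k" "d \<in> dist_colorings G k"
  shows "dist_coloring_rel G k `` {c} = dist_coloring_rel G k `` {d} \<longleftrightarrow>
         equivalent_colorings G c d"
  using assms eq_equiv_class_iff[OF equiv_dist_coloring_rel assms]
  by (auto simp: dist_coloring_rel_def)

text \<open>
  A family of pairwise non-equivalent colorings and an injection into the set of classes are the
  same thing; the next two lemmas pass from one to the other.
\<close>

lemma card_le_num_dist_colorings:
  assumes "finite (pverts G)"
    and mem: "\<And>i. i \<in> A \<Longrightarrow> c i \<in> dist_colorings G k"
    and ineq: "\<And>i j. i \<in> A \<Longrightarrow> j \<in> A \<Longrightarrow> equivalent_colorings G (c i) (c j) \<Longrightarrow> i = j"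
  shows "card A \<le> \<Phi> k G"
  unfolding num_dist_colorings_def
proof (rule card_inj_on_le)
  show "inj_on (\<lambda>i. dist_coloring_rel G k `` {c i}) A"
    using mem ineq by (auto intro!: inj_onI simp: dist_coloring_class_eq_iff)
  show "(\<lambda>i. dist_coloring_rel G k `` {c i}) ` A \<subseteq> dist_colorings G k // dist_coloring_rel G k"
    using mem by (auto intro: quotientI)
  show "finite (dist_colorings G k // dist_coloring_rel G k)"
    using finite_dist_colorings[OF assms(1)]
    by (rule finite_quotient) (auto simp: dist_coloring_rel_def)
qed

lemma exists_inequivalent_colorings:
  assumes "finite (pverts G)" "finite A" "card A \<le> \<Phi> k G"
  shows "\<exists>c. (\<forall>i\<in>A. c i \<in> dist_colorings G k) \<and>
             (\<forall>i\<in>A. \<forall>j\<in>A. equivalent_colorings G (c i) (c j) \<longrightarrow> i = j)"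
proof -
  let ?R = "dist_coloring_rel G k"
  have "finite (dist_colorings G k // ?R)"
    using finite_dist_colorings[OF assms(1)]
    by (rule finite_quotient) (auto simp: dist_coloring_rel_def)
  then obtain g where g: "inj_on g A" "g ` A \<subseteq> dist_colorings G k // ?R"
    using card_le_inj[OF assms(2)] assms(3) unfolding num_dist_colorings_def by blast
  have "\<forall>i\<in>A. \<exists>d. d \<in> dist_colorings G k \<and> g i = ?R `` {d}"
    using g(2) by (auto elim!: quotientE)
  then obtain c where c: "\<forall>i\<in>A. c i \<in> dist_colorings G k \<and> g i = ?R `` {c i}"
    by metis
  have "i = j" if ij: "i \<in> A" "j \<in> A" "equivalent_colorings G (c i) (c j)" for i j
  proof -
    have "g i = g j" using c ij dist_coloring_class_eq_iff[of "c i" G k "c j"] by simp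
    then show ?thesis using g(1) ij by (auto dest: inj_onD)
  qed
  then show ?thesis using c by (intro exI[of _ c]) simp
qed

lemma num_dist_colorings_mono:
  assumes "finite (pverts G)" "k \<le> l"
  shows "\<Phi> k G \<le> \<Phi> l G"
proof -
  obtain c where
    c: "\<forall>i\<in>{..<\<Phi> k G}. c i \<in> dist_colorings G k"
      "\<forall>i\<in>{..<\<Phi> k G}. \<forall>j\<in>{..<\<Phi> k G}. equivalent_colorings G (c i) (c j) \<longrightarrow> i = j"
    using exists_inequivalent_colorings[OF assms(1), of "{..<\<Phi> k G}" k] by auto
  have "dist_colorings G k \<subseteq> dist_colorings G l"
    using assms(2) by (fastforce simp: dist_colorings_def PiE_iff)
  then have "card {..<\<Phi> k G} \<le> \<Phi> l G"
    using c assms(1) by (intro card_le_num_dist_colorings) blast+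
  then show ?thesis by simp
qed

text \<open>
  Injective colorings are distinguishing, and those whose images are disjoint blocks of colors
  are non-equivalent, since equivalent colorings use the same colors. So \<open>\<Phi> k G\<close> is
  unbounded in \<open>k\<close>, which is what makes \<open>D_at\<close> a minimum over a nonempty set.
\<close>

lemma num_dist_colorings_unbounded:
  assumes fin: "finite (pverts G)" and ne: "pverts G \<noteq> {}"
  shows "\<exists>k\<ge>1. N \<le> \<Phi> k G"
proof -
  define n where "n = card (pverts G)"
  obtain e where e: "bij_betw e (pverts G) {0..<n}"
    using ex_bij_betw_finite_nat[OF fin] unfolding n_def by blast
  have e_less: "e v < n" if "v \<in> pverts G" for v
    using e that by (auto simp: bij_betw_def)
  \<comment> \<open>The \<open>j\<close>-th coloring uses exactly the block of colors \<open>j * n + 1, \<dots>, (j + 1) * n\<close>.\<close>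
  define c where "c j = restrict (\<lambda>v. Suc (j * n + e v)) (pverts G)" for j
  define k where "k = Suc (N * n)"
  have mem: "c j \<in> dist_colorings G k" if j: "j \<in> {..<N}" for j
  proof -
    have "j * n + e v < N * n" if "v \<in> pverts G" for v
    proof -
      have "j * n + e v < Suc j * n" using e_less[OF that] by simp
      also have "\<dots> \<le> N * n" using j by (intro mult_le_mono1) auto
      finally show ?thesis .
    qed
    then have "c j \<in> pverts G \<rightarrow>\<^sub>E {1..k}"
      by (force simp: c_def k_def)
    moreover have "distinguishing G (c j)"
      unfolding distinguishing_def
    proof (intro allI impI ballI)
      fix \<alpha> v
      assume \<alpha>: "graph_automorphism G \<alpha> \<and> (\<forall>v\<in>pverts G. c j (\<alpha> v) = c j v)"
        and v: "v \<in> pverts G"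
      have av: "\<alpha> v \<in> pverts G" using graph_automorphism_mem[OF conjunct1[OF \<alpha>] v] .
      moreover have "c j (\<alpha> v) = c j v" using \<alpha> v by blast
      ultimately have "e (\<alpha> v) = e v" using v by (simp add: c_def)
      then show "\<alpha> v = v" using e av v by (auto simp: bij_betw_def dest: inj_onD)
    qed
    ultimately show ?thesis by (simp add: dist_colorings_def)
  qed
  have "i = j" if "equivalent_colorings G (c i) (c j)" for i j
  proof -
    obtain \<alpha> where \<alpha>: "graph_automorphism G \<alpha>" "\<forall>v\<in>pverts G. c i v = c j (\<alpha> v)"
      using \<open>equivalent_colorings G (c i) (c j)\<close> by (auto simp: equivalent_colorings_def)
    obtain v where v: "v \<in> pverts G" using ne by blast
    have av: "\<alpha> v \<in> pverts G" using graph_automorphism_mem[OF \<alpha>(1) v] .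
    have "i * n + e v = j * n + e (\<alpha> v)" using \<alpha>(2) v av by (auto simp: c_def)
    then have "(i * n + e v) div n = (j * n + e (\<alpha> v)) div n" by simp
    then show "i = j" using e_less[OF v] e_less[OF av] by simp
  qed
  then have "card {..<N} \<le> \<Phi> k G"
    using mem fin by (intro card_le_num_dist_colorings) blast+
  then show ?thesis by (intro exI[of _ k]) (simp add: k_def)
qed

lemma dist_colorings_distinguishing_number:
  assumes "finite (pverts G)" "pverts G \<noteq> {}"
  shows "dist_colorings G (distinguishing_number G) \<noteq> {}"
proof -
  obtain k where "1 \<le> \<Phi> k G" using num_dist_colorings_unbounded[OF assms, of 1] by blast
  then have "dist_colorings G k \<noteq> {}" by (auto simp: num_dist_colorings_def)
  then show ?thesis unfolding distinguishing_number_def by (rule LeastI)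
qed

section \<open>Choosing the colorings of the fibres\<close>

text \<open>
  The size of \<open>C_set X Y f x\<close> lies between the two sides: the values of \<open>f\<close>
  counted here are all taken on this set, since those other than \<open>f x\<close> occur only at its
  elements and \<open>f x\<close> occurs at \<open>x\<close>; and \<open>D_at X Y f x \<le> d_max X Y f\<close> colors provide at
  least this many classes.
\<close>

lemma card_base_colors_le_num_dist_colorings:
  assumes fin: "finite (pverts X)"
    and x: "x \<in> pverts X"
    and Y: "finite (pverts (Y x))" "pverts (Y x) \<noteq> {}"
  shows "card (f ` {w \<in> pverts X. isomorphic_graphs (Y x) (Y w)}) \<le> \<Phi> (d_max X Y f) (Y x)"
proof -
  let ?k = "D_at X Y f x"
  have C_fin: "finite (C_set X Y f x)" using fin by (simp add: C_set_def)
  have "f ` {w \<in> pverts X. isomorphic_graphs (Y x) (Y w)} \<subseteq> f ` C_set X Y f x"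
    by (auto simp: C_set_def image_iff)
  then have "card (f ` {w \<in> pverts X. isomorphic_graphs (Y x) (Y w)}) \<le> card (f ` C_set X Y f x)"
    using C_fin by (intro card_mono) auto
  also have "\<dots> \<le> card (C_set X Y f x)" using C_fin by (rule card_image_le)
  also have "\<dots> \<le> \<Phi> ?k (Y x)"
  proof -
    have "\<exists>k. 1 \<le> k \<and> card (C_set X Y f x) \<le> \<Phi> k (Y x)"
      using num_dist_colorings_unbounded[OF Y] by blast
    then have "1 \<le> ?k \<and> card (C_set X Y f x) \<le> \<Phi> ?k (Y x)"
      unfolding D_at_def by (rule LeastI_ex)
    then show ?thesis ..
  qed
  also have "\<dots> \<le> \<Phi> (d_max X Y f) (Y x)"
    using fin x Y(1) by (intro num_dist_colorings_mono) (auto simp: d_max_def)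
  finally show ?thesis .
qed

text \<open>
  In each isomorphism class of fibres, a representative receives one coloring for every value of
  \<open>f\<close> on the class, pairwise non-equivalent. Pulling these back along isomorphisms to the
  representative makes \<open>(Y x, h x)\<close> and \<open>(Y w, h w)\<close> color-isomorphic only if they use the same
  coloring of the representative.
\<close>

lemma exists_fibre_colorings:
  fixes Y :: "'a \<Rightarrow> 'b pair_pre_digraph" and f :: "'a \<Rightarrow> 'c"
  assumes fin: "finite V"
    and Y: "\<And>x. x \<in> V \<Longrightarrow> finite (pverts (Y x))"
    and card: "\<And>x. x \<in> V \<Longrightarrow> card (f ` {w \<in> V. isomorphic_graphs (Y x) (Y w)}) \<le> \<Phi> k (Y x)"
  obtains h where "\<And>x. x \<in> V \<Longrightarrow> h x \<in> dist_colorings (Y x) k"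
    and "\<And>x w. x \<in> V \<Longrightarrow> w \<in> V \<Longrightarrow> color_isomorphic (Y x) (h x) (Y w) (h w) \<Longrightarrow> f x = f w"
proof -
  define r where "r x = (SOME w. w \<in> V \<and> isomorphic_graphs (Y x) (Y w))" for x
  have r: "r x \<in> V \<and> isomorphic_graphs (Y x) (Y (r x))" if "x \<in> V" for x
    unfolding r_def using that isomorphic_graphs_refl
    by (intro someI[where P = "\<lambda>w. w \<in> V \<and> isomorphic_graphs (Y x) (Y w)"]) blast
  have r_cong: "r x = r w" if "isomorphic_graphs (Y x) (Y w)" for x w
  proof -
    have "isomorphic_graphs (Y x) (Y z) \<longleftrightarrow> isomorphic_graphs (Y w) (Y z)" for z
      using that isomorphic_graphs_sym isomorphic_graphs_trans by blast
    then show ?thesis by (simp add: r_def)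
  qed
  let ?F = "\<lambda>x. f ` {w \<in> V. isomorphic_graphs (Y x) (Y w)}"
  have "\<forall>x\<in>V. \<exists>c. (\<forall>i\<in>?F x. c i \<in> dist_colorings (Y x) k) \<and>
          (\<forall>i\<in>?F x. \<forall>j\<in>?F x. equivalent_colorings (Y x) (c i) (c j) \<longrightarrow> i = j)"
    using fin by (intro ballI exists_inequivalent_colorings Y card) simp_all
  from bchoice[OF this] obtain c where
    c: "\<forall>x\<in>V. (\<forall>i\<in>?F x. c x i \<in> dist_colorings (Y x) k) \<and>
          (\<forall>i\<in>?F x. \<forall>j\<in>?F x. equivalent_colorings (Y x) (c x i) (c x j) \<longrightarrow> i = j)" ..
  have c_mem: "c x i \<in> dist_colorings (Y x) k" if "x \<in> V" "i \<in> ?F x" for x i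
    using bspec[OF conjunct1[OF bspec[OF c that(1)]] that(2)] .
  have c_inj: "i = j"
    if "x \<in> V" "i \<in> ?F x" "j \<in> ?F x" "equivalent_colorings (Y x) (c x i) (c x j)" for x i j
    using bspec[OF bspec[OF conjunct2[OF bspec[OF c that(1)]] that(2)] that(3)] that(4) by (rule mp)
  have "\<forall>x\<in>V. \<exists>\<phi>. graph_isomorphism (Y x) (Y (r x)) \<phi>"
    using r by (simp add: isomorphic_graphs_def)
  then obtain \<phi> where \<phi>: "\<And>x. x \<in> V \<Longrightarrow> graph_isomorphism (Y x) (Y (r x)) (\<phi> x)"
    by metis
  define h where "h x = restrict (\<lambda>y. c (r x) (f x) (\<phi> x y)) (pverts (Y x))" for x
  have val: "f x \<in> ?F (r x)" if "x \<in> V" for x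
    using that r[OF that] isomorphic_graphs_sym by blast
  have h_iso: "color_isomorphic (Y x) (h x) (Y (r x)) (c (r x) (f x))" if "x \<in> V" for x
    unfolding color_isomorphic_def using \<phi>[OF that] by (auto simp: h_def intro!: exI[of _ "\<phi> x"])
  show ?thesis
  proof
    fix x assume x: "x \<in> V"
    then have c: "c (r x) (f x) \<in> dist_colorings (Y (r x)) k"
      using c_mem[OF conjunct1[OF r[OF x]] val[OF x]] by simp
    then have "h x \<in> pverts (Y x) \<rightarrow>\<^sub>E {1..k}"
      using graph_isomorphism_mem[OF \<phi>[OF x]]
      by (fastforce simp: h_def dist_colorings_def PiE_iff)
    moreover have "distinguishing (Y x) (h x)"
      using distinguishing_color_isomorphic[OF h_iso[OF x]] c by (simp add: dist_colorings_def)
    ultimately show "h x \<in> dist_colorings (Y x) k" by (simp add: dist_colorings_def)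
  next
    fix x w assume x: "x \<in> V" and w: "w \<in> V"
      and xw: "color_isomorphic (Y x) (h x) (Y w) (h w)"
    have rw: "r x = r w" using r_cong[OF color_isomorphic_imp_isomorphic[OF xw]] .
    have "color_isomorphic (Y (r x)) (c (r x) (f x)) (Y (r w)) (c (r w) (f w))"
      using color_isomorphic_trans[OF
          color_isomorphic_trans[OF color_isomorphic_sym[OF h_iso[OF x]] xw] h_iso[OF w]] .
    then have "equivalent_colorings (Y (r x)) (c (r x) (f x)) (c (r x) (f w))"
      by (simp add: rw color_isomorphic_same_graph)
    then show "f x = f w"
      using c_inj[OF conjunct1[OF r[OF x]] val[OF x]] val[OF w] by (simp only: rw)
  qed
qed

section \<open>Automorphisms of the join\<close>

text \<open>
  The induced permutation \<open>\<pi>\<close> of the base preserves adjacency because any vertices of two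
  different nonempty fibres witness whether their base points are adjacent.
\<close>

lemma natural_automorphism_induces:
  assumes X: "fin_simple_graph X"
    and Y: "\<And>x. x \<in> pverts X \<Longrightarrow> pverts (Y x) \<noteq> {}"
    and \<mu>: "graph_automorphism (X_join X Y) \<mu>" "natural X Y \<mu>"
  shows "\<exists>\<pi>. graph_automorphism X \<pi> \<and>
           (\<forall>x\<in>pverts X. (\<forall>y\<in>pverts (Y x). fst (\<mu> (x, y)) = \<pi> x) \<and>
              graph_isomorphism (Y x) (Y (\<pi> x)) (\<lambda>y. snd (\<mu> (x, y))))"
proof -
  interpret X: pair_graph X using X by (simp add: fin_simple_graph_def)
  have noloop: "(x, x) \<notin> parcs X" for x using X.pair_no_loops[of "(x, x)"] by auto
  let ?Z = "X_join X Y"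
  have inj: "inj_on \<mu> (pverts ?Z)"
    and adj: "\<And>u v. u \<in> pverts ?Z \<Longrightarrow> v \<in> pverts ?Z \<Longrightarrow>
                (u, v) \<in> parcs ?Z \<longleftrightarrow> (\<mu> u, \<mu> v) \<in> parcs ?Z"
    using \<mu>(1) by (auto simp: graph_automorphism_def graph_isomorphism_def bij_betw_def)
  have sub: "fibre Y x \<subseteq> pverts ?Z" if "x \<in> pverts X" for x
    using that by (auto simp: fibre_def X_join_def)
  obtain \<pi> where \<pi>: "\<And>x. x \<in> pverts X \<Longrightarrow> \<pi> x \<in> pverts X"
    "\<And>x. x \<in> pverts X \<Longrightarrow> \<mu> ` fibre Y x = fibre Y (\<pi> x)"
    using \<mu>(2) unfolding natural_def by metis
  have mem: "\<mu> (x, y) \<in> fibre Y (\<pi> x)" if "x \<in> pverts X" "y \<in> pverts (Y x)" for x y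
    using that \<pi>(2)[OF that(1)] by (auto simp: fibre_def)
  have eq: "\<mu> (x, y) = (\<pi> x, snd (\<mu> (x, y)))" "snd (\<mu> (x, y)) \<in> pverts (Y (\<pi> x))"
    if "x \<in> pverts X" "y \<in> pverts (Y x)" for x y
    using mem[OF that] by (auto simp: fibre_def)
  have \<pi>_inj: "inj_on \<pi> (pverts X)"
  proof (rule inj_onI)
    fix x x' assume x: "x \<in> pverts X" "x' \<in> pverts X" "\<pi> x = \<pi> x'"
    then have "\<mu> ` fibre Y x = \<mu> ` fibre Y x'" using \<pi>(2) by simp
    then have "fibre Y x = fibre Y x'"
      using inj_on_image_eq_iff[OF inj sub sub] x by blast
    then show "x = x'" using Y x unfolding fibre_def by blast
  qed
  have \<pi>_bij: "bij_betw \<pi> (pverts X) (pverts X)"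
    using endo_inj_surj[OF X.pair_finite_verts _ \<pi>_inj] \<pi>(1) \<pi>_inj
    by (auto simp: bij_betw_def)
  have "graph_automorphism X \<pi>"
    unfolding graph_automorphism_def graph_isomorphism_def
  proof (intro conjI ballI)
    show "bij_betw \<pi> (pverts X) (pverts X)" by (rule \<pi>_bij)
    fix u v assume uv: "u \<in> pverts X" "v \<in> pverts X"
    show "(u, v) \<in> parcs X \<longleftrightarrow> (\<pi> u, \<pi> v) \<in> parcs X"
    proof (cases "u = v")
      case True
      then show ?thesis using noloop by simp
    next
      case False
      then have ne: "\<pi> u \<noteq> \<pi> v" using \<pi>_inj uv by (auto dest: inj_onD)
      obtain a b where ab: "a \<in> pverts (Y u)" "b \<in> pverts (Y v)" using Y uv by blast
      have "(u, v) \<in> parcs X \<longleftrightarrow> ((u, a), (v, b)) \<in> parcs ?Z"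
        using uv ab False by (auto simp: X_join_def)
      also have "\<dots> \<longleftrightarrow> (\<mu> (u, a), \<mu> (v, b)) \<in> parcs ?Z"
        using uv ab by (intro adj) (auto simp: X_join_def)
      also have "\<dots> \<longleftrightarrow> (\<pi> u, \<pi> v) \<in> parcs X"
        using eq[OF uv(1) ab(1)] eq[OF uv(2) ab(2)] \<pi>(1) uv ne
        by (cases "\<mu> (u, a)"; cases "\<mu> (v, b)") (auto simp: X_join_def)
      finally show ?thesis .
    qed
  qed
  moreover have "graph_isomorphism (Y x) (Y (\<pi> x)) (\<lambda>y. snd (\<mu> (x, y)))" if x: "x \<in> pverts X" for x
    unfolding graph_isomorphism_def
  proof (intro conjI ballI)
    have "inj_on (\<lambda>y. snd (\<mu> (x, y))) (pverts (Y x))"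
    proof (rule inj_onI)
      fix y y' assume y: "y \<in> pverts (Y x)" "y' \<in> pverts (Y x)"
        and s: "snd (\<mu> (x, y)) = snd (\<mu> (x, y'))"
      then have "\<mu> (x, y) = \<mu> (x, y')" using eq(1)[OF x y(1)] eq(1)[OF x y(2)] by simp
      then show "y = y'" using inj x y by (auto simp: X_join_def dest: inj_onD)
    qed
    moreover have "(\<lambda>y. snd (\<mu> (x, y))) ` pverts (Y x) = snd ` (\<mu> ` fibre Y x)"
      by (force simp: fibre_def)
    moreover have "snd ` fibre Y (\<pi> x) = pverts (Y (\<pi> x))" by (force simp: fibre_def)
    ultimately show "bij_betw (\<lambda>y. snd (\<mu> (x, y))) (pverts (Y x)) (pverts (Y (\<pi> x)))"
      using \<pi>(2)[OF x] by (simp add: bij_betw_def)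
  next
    fix u v assume uv: "u \<in> pverts (Y x)" "v \<in> pverts (Y x)"
    have "(u, v) \<in> parcs (Y x) \<longleftrightarrow> ((x, u), (x, v)) \<in> parcs ?Z"
      using x uv noloop by (auto simp: X_join_def)
    also have "\<dots> \<longleftrightarrow> (\<mu> (x, u), \<mu> (x, v)) \<in> parcs ?Z"
      using x uv by (intro adj) (auto simp: X_join_def)
    also have "\<dots> \<longleftrightarrow> (snd (\<mu> (x, u)), snd (\<mu> (x, v))) \<in> parcs (Y (\<pi> x))"
      using eq[OF x uv(1)] eq[OF x uv(2)] \<pi>(1)[OF x] noloop
      by (cases "\<mu> (x, u)"; cases "\<mu> (x, v)") (auto simp: X_join_def)
    finally show "(u, v) \<in> parcs (Y x) \<longleftrightarrow> (snd (\<mu> (x, u)), snd (\<mu> (x, v))) \<in> parcs (Y (\<pi> x))" .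
  qed
  moreover have "fst (\<mu> (x, y)) = \<pi> x" if "x \<in> pverts X" "y \<in> pverts (Y x)" for x y
    using mem[OF that] by (auto simp: fibre_def)
  ultimately show ?thesis by (intro exI[of _ \<pi>]) simp
qed

lemma distinguishing_X_join:
  assumes X: "fin_simple_graph X"
    and Y: "\<And>x. x \<in> pverts X \<Longrightarrow> pverts (Y x) \<noteq> {}"
    and nat: "\<And>\<mu>. graph_automorphism (X_join X Y) \<mu> \<Longrightarrow> natural X Y \<mu>"
    and f: "distinguishing X f"
    and h: "\<And>x. x \<in> pverts X \<Longrightarrow> distinguishing (Y x) (h x)"
    and sep: "\<And>x w. x \<in> pverts X \<Longrightarrow> w \<in> pverts X \<Longrightarrow>
                color_isomorphic (Y x) (h x) (Y w) (h w) \<Longrightarrow> f x = f w"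
    and c: "\<And>x y. x \<in> pverts X \<Longrightarrow> y \<in> pverts (Y x) \<Longrightarrow> c (x, y) = h x y"
  shows "distinguishing (X_join X Y) c"
  unfolding distinguishing_def
proof (intro allI impI ballI)
  fix \<mu> v
  assume \<mu>: "graph_automorphism (X_join X Y) \<mu> \<and> (\<forall>v\<in>pverts (X_join X Y). c (\<mu> v) = c v)"
    and v: "v \<in> pverts (X_join X Y)"
  obtain \<pi> where \<pi>: "graph_automorphism X \<pi>"
    and fst: "\<And>x y. x \<in> pverts X \<Longrightarrow> y \<in> pverts (Y x) \<Longrightarrow> fst (\<mu> (x, y)) = \<pi> x"
    and iso: "\<And>x. x \<in> pverts X \<Longrightarrow> graph_isomorphism (Y x) (Y (\<pi> x)) (\<lambda>y. snd (\<mu> (x, y)))"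
    using natural_automorphism_induces[OF X Y conjunct1[OF \<mu>] nat[OF conjunct1[OF \<mu>]]] by auto
  have \<pi>_mem: "\<pi> x \<in> pverts X" if "x \<in> pverts X" for x
    using graph_automorphism_mem[OF \<pi> that] .
  have col: "h (\<pi> x) (snd (\<mu> (x, y))) = h x y" if xy: "x \<in> pverts X" "y \<in> pverts (Y x)" for x y
  proof -
    have "c (\<mu> (x, y)) = c (x, y)" using \<mu> xy by (auto simp: X_join_def)
    moreover have "\<mu> (x, y) = (\<pi> x, snd (\<mu> (x, y)))" using fst[OF xy] by (simp add: prod_eq_iff)
    moreover have "snd (\<mu> (x, y)) \<in> pverts (Y (\<pi> x))"
      using graph_isomorphism_mem[OF iso[OF xy(1)] xy(2)] .
    ultimately show ?thesis using c \<pi>_mem xy by metis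
  qed
  have "f (\<pi> x) = f x" if x: "x \<in> pverts X" for x
  proof -
    have "color_isomorphic (Y x) (h x) (Y (\<pi> x)) (h (\<pi> x))"
      unfolding color_isomorphic_def using iso[OF x] col[OF x] by metis
    then show ?thesis using sep[OF x \<pi>_mem[OF x]] by simp
  qed
  then have \<pi>_id: "\<pi> x = x" if "x \<in> pverts X" for x
    using f \<pi> that unfolding distinguishing_def by blast
  obtain x y where xy: "v = (x, y)" "x \<in> pverts X" "y \<in> pverts (Y x)"
    using v by (auto simp: X_join_def)
  have "graph_automorphism (Y x) (\<lambda>y. snd (\<mu> (x, y)))"
    using iso[OF xy(2)] by (simp add: graph_automorphism_def \<pi>_id[OF xy(2)])
  moreover have "\<forall>y\<in>pverts (Y x). h x (snd (\<mu> (x, y))) = h x y"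
    using col[OF xy(2)] by (simp add: \<pi>_id[OF xy(2)])
  ultimately have "snd (\<mu> (x, y)) = y"
    using h[OF xy(2)] xy(3) unfolding distinguishing_def by blast
  then show "\<mu> v = v" using fst[OF xy(2,3)] \<pi>_id[OF xy(2)] unfolding xy(1) by (simp add: prod_eq_iff)
qed

section \<open>The bound\<close>

lemma distinguishing_number_X_join_le_d_max:
  assumes X: "fin_simple_graph X"
    and Y: "\<And>x. x \<in> pverts X \<Longrightarrow> fin_simple_graph (Y x)"
    and nat: "\<And>\<mu>. graph_automorphism (X_join X Y) \<mu> \<Longrightarrow> natural X Y \<mu>"
    and f: "distinguishing X f"
  shows "distinguishing_number (X_join X Y) \<le> d_max X Y f"
proof -
  let ?k = "d_max X Y f"
  have finX: "finite (pverts X)" using X by (rule fin_simple_graph_finite)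
  have Yf: "finite (pverts (Y x))" "pverts (Y x) \<noteq> {}" if "x \<in> pverts X" for x
    using Y[OF that] fin_simple_graph_finite by (auto simp: fin_simple_graph_def)
  have "card (f ` {w \<in> pverts X. isomorphic_graphs (Y x) (Y w)}) \<le> \<Phi> ?k (Y x)"
    if "x \<in> pverts X" for x
    using card_base_colors_le_num_dist_colorings[OF finX that] Yf[OF that] by blast
  then obtain h where h: "\<And>x. x \<in> pverts X \<Longrightarrow> h x \<in> dist_colorings (Y x) ?k"
    and sep: "\<And>x w. x \<in> pverts X \<Longrightarrow> w \<in> pverts X \<Longrightarrow>
                color_isomorphic (Y x) (h x) (Y w) (h w) \<Longrightarrow> f x = f w"
    using exists_fibre_colorings[OF finX, of Y f ?k] Yf(1) by blast
  define c where "c = restrict (\<lambda>(x, y). h x y) (pverts (X_join X Y))"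
  have c: "c (x, y) = h x y" if "x \<in> pverts X" "y \<in> pverts (Y x)" for x y
    using that by (simp add: c_def X_join_def)
  have "distinguishing (X_join X Y) c"
  proof (rule distinguishing_X_join[where h = h, OF X Yf(2) nat f])
    show "distinguishing (Y x) (h x)" if "x \<in> pverts X" for x
      using h[OF that] by (simp add: dist_colorings_def)
  qed (use sep c in blast)+
  moreover have "c \<in> pverts (X_join X Y) \<rightarrow>\<^sub>E {1..?k}"
    using h by (fastforce simp: c_def X_join_def dist_colorings_def PiE_iff)
  ultimately have "dist_colorings (X_join X Y) ?k \<noteq> {}" by (auto simp: dist_colorings_def)
  then show ?thesis unfolding distinguishing_number_def by (rule Least_le)
qed

theorem theorem5p2:
  fixes X :: "'a pair_pre_digraph"
    and Y :: "'a \<Rightarrow> 'b pair_pre_digraph"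
    and Z :: "('a \<times> 'b) pair_pre_digraph"
    and S :: "('a \<Rightarrow> nat) set"
  assumes "fin_simple_graph X"
    and "\<And>x. x \<in> pverts X \<Longrightarrow> fin_simple_graph (Y x)"
    and "Z = X_join X Y"
    and "\<And>\<mu>. graph_automorphism Z \<mu> \<Longrightarrow> natural X Y \<mu>"
    and "dist_coloring_representatives X (distinguishing_number X) S"
  shows "distinguishing_number Z \<le> Min {d_max X Y f | f. f \<in> S}"
proof -
  interpret X: pair_graph X using assms(1) by (simp add: fin_simple_graph_def)
  let ?D = "dist_colorings X (distinguishing_number X)"
  have S: "S \<subseteq> ?D" "\<forall>c\<in>?D. \<exists>f. f \<in> S"
    using assms(5) unfolding dist_coloring_representatives_def by blast+
  \<comment> \<open>\<open>Min\<close> is the minimum only over a finite nonempty set.\<close>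
  have "finite S" using S(1) finite_dist_colorings[OF X.pair_finite_verts] by (rule finite_subset)
  moreover have "S \<noteq> {}"
    using S(2) dist_colorings_distinguishing_number[OF X.pair_finite_verts] assms(1)
    by (auto simp: fin_simple_graph_def)
  moreover have "distinguishing_number Z \<le> d_max X Y f" if "f \<in> S" for f
    using distinguishing_number_X_join_le_d_max[OF assms(1,2)] assms(3,4) S(1) that
    by (auto simp: dist_colorings_def)
  moreover have "{d_max X Y f | f. f \<in> S} = d_max X Y ` S" by blast
  ultimately show ?thesis by simp
qed

end
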